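(* Let $n\ge1$. Let $A_n(t)=\sum_{\pi\in\mathfrak{S}_n}t^{\mathrm{des}(\pi)}$ be the Eulerian polynomial, where $\mathfrak{S}_n$ is the set of permutations of $[n]$ and $\mathrm{des}(\pi)=|\{i\in[n-1]:\pi_i>\pi_{i+1}\}|$. A segmented permutation of $[n]$ is a permutation $\sigma=\sigma_1\cdots\sigma_n$ of $[n]$ together with a choice, for each slot between consecutive letters $\sigma_i,\sigma_{i+1}$ ($1\le i\le n-1$), of whether a bar is placed there; let $\mathcal{SP}_n$ be the set of these. For $\sigma\in\mathcal{SP}_n$ let $\mathrm{des}(\sigma)$ be the number of $i\in[n-1]$ with $\sigma_i>\sigma_{i+1}$ and no bar between $\sigma_i$ and $\sigma_{i+1}$, and $\mathrm{seg}(\sigma)$ the number of bars. Let $\alpha_n(t,q)=\sum_{\sigma\in\mathcal{SP}_n}t^{\mathrm{des}(\sigma)}q^{\mathrm{seg}(\sigma)}$ and $P_n(t)=\sum_{\sigma\in\mathcal{SP}_n}t^{\mathrm{des}(\sigma)}$. Then $$\alpha_n(t,q)=(1+q)^{n-1}A_n\!\left(\frac{t+q}{1+q}\right)\quad\text{and}\quad P_n(t)=2^{n-1}A_n\!\left(\frac{t+1}{2}\right).$$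
   Context: The first identity is an identity of polynomials: writing $A_n(t)=\sum_{k=0}^{n-1}A(n,k)t^k$, its right-hand side means $\sum_{k=0}^{n-1}A(n,k)(t+q)^k(1+q)^{n-1-k}$. *)

theory Defs
  imports
    "HOL-Combinatorics.Permutations"
    "HOL-Computational_Algebra.Polynomial"
begin

definition des :: "nat \<Rightarrow> (nat \<Rightarrow> nat) \<Rightarrow> nat" where
  "des n \<pi> = card {i \<in> {1..n-1}. \<pi> i > \<pi> (i + 1)}"

definition eulerian_poly :: "nat \<Rightarrow> int poly" where
  "eulerian_poly n = (\<Sum>\<pi> | \<pi> permutes {1..n}. monom 1 (des n \<pi>))"

text \<open>A segmented permutation is a pair of a permutation and the set of barred slots,
  where slot \<open>i\<close> is the one between the letters \<open>\<sigma> i\<close> and \<open>\<sigma> (i + 1)\<close>.\<close>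

definition segmented_perms :: "nat \<Rightarrow> ((nat \<Rightarrow> nat) \<times> nat set) set" where
  "segmented_perms n = {\<sigma>. \<sigma> permutes {1..n}} \<times> Pow {1..n-1}"

definition sdes :: "nat \<Rightarrow> (nat \<Rightarrow> nat) \<times> nat set \<Rightarrow> nat" where
  "sdes n = (\<lambda>(\<sigma>, B). card {i \<in> {1..n-1}. \<sigma> i > \<sigma> (i + 1) \<and> i \<notin> B})"

definition seg :: "(nat \<Rightarrow> nat) \<times> nat set \<Rightarrow> nat" where
  "seg = (\<lambda>(\<sigma>, B). card B)"

text \<open>Bivariate polynomials are elements of \<open>\<int>[t][q]\<close>: the inner variable is \<open>t\<close>,
  the outer one is \<open>q\<close>.\<close>

definition var_t :: "int poly poly" where
  "var_t = [:[:0, 1:]:]"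

definition var_q :: "int poly poly" where
  "var_q = [:0, 1:]"

definition alpha_poly :: "nat \<Rightarrow> int poly poly" where
  "alpha_poly n = (\<Sum>\<sigma>\<in>segmented_perms n. var_t ^ sdes n \<sigma> * var_q ^ seg \<sigma>)"

definition P_poly :: "nat \<Rightarrow> int poly" where
  "P_poly n = (\<Sum>\<sigma>\<in>segmented_perms n. monom 1 (sdes n \<sigma>))"

end

theory Submission
  imports Defs
begin

text \<open>Fix a permutation with descent set \<open>D\<close>. Summing over all sets \<open>B\<close> of bars, every slot
  contributes a factor independently of the others: \<open>t + q\<close> if it is a descent, since a bar erases
  the descent, and \<open>1 + q\<close> otherwise.\<close>

lemma sum_Pow_powers_card:
  fixes x y :: "'a::comm_ring_1"
  assumes "finite I" "D \<subseteq> I"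
  shows "(\<Sum>B\<in>Pow I. x ^ card (D - B) * y ^ card B) = (x + y) ^ card D * (1 + y) ^ (card I - card D)"
proof -
  \<comment> \<open>The weight of a slot without a bar; a slot with a bar has weight
    \<open>y\<close>, whether or not it is a descent.\<close>
  let ?w = "\<lambda>i. if i \<in> D then x else 1"
  have "x ^ card (D - B) * y ^ card B = (\<Prod>i\<in>B. y) * prod ?w (I - B)" if "B \<subseteq> I" for B
  proof -
    have "prod ?w (I - B) = (\<Prod>i\<in>(I - B) \<inter> D. x)"
      using assms(1) by (intro prod.inter_restrict[symmetric]) simp
    also have "(I - B) \<inter> D = D - B"
      using assms(2) by blast
    finally show ?thesis
      by (simp add: mult.commute)
  qed
  then have "(\<Sum>B\<in>Pow I. x ^ card (D - B) * y ^ card B) = (\<Sum>B\<in>Pow I. (\<Prod>i\<in>B. y) * prod ?w (I - B))"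
    by (intro sum.cong) auto
  \<comment> \<open>Expanding the product means choosing one summand per slot, and \<open>B\<close>
    records where \<open>y\<close> is chosen.\<close>
  also have "\<dots> = (\<Prod>i\<in>I. y + ?w i)"
    using assms(1) by (rule prod_add[symmetric])
  also have "\<dots> = (\<Prod>i\<in>D. y + ?w i) * (\<Prod>i\<in>I - D. y + ?w i)"
    by (subst prod.subset_diff[OF assms(2,1)]) (rule mult.commute)
  also have "\<dots> = (x + y) ^ card D * (1 + y) ^ (card I - card D)"
    using assms by (simp add: card_Diff_subset finite_subset add.commute)
  finally show ?thesis .
qed

lemma des_le: "des n \<pi> \<le> n - 1"
  unfolding des_def by (rule order_trans[OF card_mono[of "{1..n-1}"]]) auto

text \<open>The ring is left arbitrary so that both identities are instances: \<open>var_t\<close>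
  and \<open>var_q\<close> over the integers give the first, the rational polynomials
  \<open>[:0, 1:]\<close> and \<open>1\<close> the second.\<close>

lemma sum_segmented_perms:
  fixes x y :: "'a::comm_ring_1"
  shows "(\<Sum>\<sigma>\<in>segmented_perms n. x ^ sdes n \<sigma> * y ^ seg \<sigma>) =
    (\<Sum>\<pi> | \<pi> permutes {1..n}. (x + y) ^ des n \<pi> * (1 + y) ^ (n - 1 - des n \<pi>))"
proof -
  let ?D = "\<lambda>\<pi>. {i \<in> {1..n-1}. \<pi> i > \<pi> (i + 1)}"
  have "(\<Sum>\<sigma>\<in>segmented_perms n. x ^ sdes n \<sigma> * y ^ seg \<sigma>) =
    (\<Sum>\<pi> | \<pi> permutes {1..n}. \<Sum>B\<in>Pow {1..n-1}. x ^ sdes n (\<pi>, B) * y ^ seg (\<pi>, B))"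
    unfolding segmented_perms_def
    by (simp add: sum.cartesian_product)
  also have "\<dots> = (\<Sum>\<pi> | \<pi> permutes {1..n}. \<Sum>B\<in>Pow {1..n-1}. x ^ card (?D \<pi> - B) * y ^ card B)"
  proof -
    have "sdes n (\<pi>, B) = card (?D \<pi> - B)" for \<pi> B
      unfolding sdes_def by (auto intro: arg_cong[where f = card])
    then show ?thesis
      by (simp add: seg_def)
  qed
  also have "\<dots> = (\<Sum>\<pi> | \<pi> permutes {1..n}. (x + y) ^ des n \<pi> * (1 + y) ^ (n - 1 - des n \<pi>))"
    by (intro sum.cong refl, subst sum_Pow_powers_card) (auto simp: des_def)
  finally show ?thesis .
qed

text \<open>Group the permutations by descent number: coefficient \<open>k\<close> of
  \<open>eulerian_poly n\<close> counts those with exactly \<open>k\<close> descents, and by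
  \<open>des_le\<close> no \<open>k\<close> above \<open>n - 1\<close> occurs.\<close>

lemma sum_des_eq_sum_coeff_eulerian_poly:
  fixes f :: "nat \<Rightarrow> 'a::comm_ring_1"
  shows "(\<Sum>\<pi> | \<pi> permutes {1..n}. f (des n \<pi>)) =
    (\<Sum>k=0..n-1. of_int (coeff (eulerian_poly n) k) * f k)"
proof -
  have "(\<Sum>k=0..n-1. of_int (coeff (eulerian_poly n) k) * f k) =
    (\<Sum>k=0..n-1. \<Sum>\<pi> | \<pi> permutes {1..n}. if des n \<pi> = k then f k else 0)"
    by (auto simp: eulerian_poly_def coeff_sum sum_distrib_right intro!: sum.cong)
  also have "\<dots> = (\<Sum>\<pi> | \<pi> permutes {1..n}. \<Sum>k=0..n-1. if des n \<pi> = k then f k else 0)"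
    by (rule sum.swap)
  also have "\<dots> = (\<Sum>\<pi> | \<pi> permutes {1..n}. f (des n \<pi>))"
    using des_le by (intro sum.cong) (auto simp: sum.delta)
  finally show ?thesis ..
qed

text \<open>Brings \<open>P_poly\<close> and \<open>eulerian_poly\<close> into sums of powers of the
  variable over the rationals, where the substitution with coefficients \<open>1/2\<close> makes
  sense.\<close>

lemma map_poly_of_int_sum_monom:
  "map_poly rat_of_int (\<Sum>a\<in>A. monom 1 (g a)) = (\<Sum>a\<in>A. [:0, 1:] ^ g a)"
proof -
  have "[:0, 1:] ^ k = monom (1::rat) k" for k
    by (simp add: monom_altdef)
  then show ?thesis
    by (intro poly_eqI) (auto simp: coeff_map_poly coeff_sum intro!: sum.cong)
qed

lemma pcompose_power: "pcompose (p ^ k) q = pcompose p q ^ k" for p q :: "'a::comm_ring_1 poly"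
  by (induction k) (simp_all add: pcompose_mult one_pCons pcompose_pCons)

theorem theorem3p4:
  fixes n :: nat
  assumes "n \<ge> 1"
  shows "alpha_poly n =
           (\<Sum>k=0..n-1. of_int (coeff (eulerian_poly n) k) *
              (var_t + var_q) ^ k * (1 + var_q) ^ (n - 1 - k))
       \<and> map_poly rat_of_int (P_poly n) =
           smult (2 ^ (n - 1)) (pcompose (map_poly rat_of_int (eulerian_poly n)) [:1/2, 1/2:])"
proof
  show "alpha_poly n =
           (\<Sum>k=0..n-1. of_int (coeff (eulerian_poly n) k) *
              (var_t + var_q) ^ k * (1 + var_q) ^ (n - 1 - k))"
    unfolding alpha_poly_def sum_segmented_perms
    by (subst sum_des_eq_sum_coeff_eulerian_poly) (simp add: mult.assoc)
next
  \<comment> \<open>The summand at q = 1: writing t + 1 as twice (t + 1)/2 gives \<open>d\<close>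
    factors 2, which join the other \<open>n - 1 - d\<close> to a power independent of
    \<open>d\<close>. The bound on \<open>d\<close> keeps the natural subtraction from
    truncating.\<close>
  have scale: "([:0, 1:] + 1) ^ d * (1 + 1) ^ (n - 1 - d) =
    smult (2 ^ (n - 1)) ([:1/2, 1/2 :: rat:] ^ d)" if "d \<le> n - 1" for d :: nat
  proof -
    have "[:0, 1:] + 1 = smult 2 [:1/2, 1/2 :: rat:]"
      by (simp add: one_pCons)
    then have "([:0, 1:] + 1) ^ d = smult (2 ^ d) ([:1/2, 1/2 :: rat:] ^ d)"
      by (simp only: smult_power)
    moreover have "(1 + 1) ^ (n - 1 - d) = [:2 ^ (n - 1 - d) :: rat:]"
      by (simp add: poly_const_pow[symmetric] numeral_poly)
    ultimately have "([:0, 1:] + 1) ^ d * (1 + 1) ^ (n - 1 - d) =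
      smult (2 ^ d * 2 ^ (n - 1 - d)) ([:1/2, 1/2 :: rat:] ^ d)"
      by (simp add: mult.commute)
    also have "(2::rat) ^ d * 2 ^ (n - 1 - d) = 2 ^ (n - 1)"
      using that by (simp flip: power_add)
    finally show ?thesis .
  qed
  \<comment> \<open>The factor \<open>1 ^ seg \<sigma>\<close> is inserted to match
    \<open>sum_segmented_perms\<close> with \<open>y = 1\<close>.\<close>
  have "map_poly rat_of_int (P_poly n) = (\<Sum>\<sigma>\<in>segmented_perms n. [:0, 1:] ^ sdes n \<sigma> * 1 ^ seg \<sigma>)"
    unfolding P_poly_def map_poly_of_int_sum_monom by simp
  also have "\<dots> = (\<Sum>\<pi> | \<pi> permutes {1..n}. smult (2 ^ (n - 1)) ([:1/2, 1/2:] ^ des n \<pi>))"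
    unfolding sum_segmented_perms by (intro sum.cong refl scale des_le)
  \<comment> \<open>Composition is additive and multiplicative, so it only replaces the variable in
    each power by (t + 1)/2.\<close>
  also have "\<dots> = smult (2 ^ (n - 1))
      (pcompose (\<Sum>\<pi> | \<pi> permutes {1..n}. [:0, 1:] ^ des n \<pi>) [:1/2, 1/2:])"
    by (intro poly_eqI)
      (simp add: pcompose_sum pcompose_power pcompose_pCons coeff_sum sum_distrib_left)
  finally show "map_poly rat_of_int (P_poly n) =
      smult (2 ^ (n - 1)) (pcompose (map_poly rat_of_int (eulerian_poly n)) [:1/2, 1/2:])"
    unfolding eulerian_poly_def map_poly_of_int_sum_monom .
qed

end
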